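(* Let $a\ge 1$ be a constant and let $k,n$ be integers with $1\le k\le n$. Let $0\le X_1\le X_2\le\dots\le X_n$ be the initial (random) positions of $n$ sensors on $[0,\infty)$, generated by an arbitrary random process, and let $M_1,\dots,M_n$ be real displacements with $X_1+M_1\le X_2+M_2\le\dots\le X_n+M_n$. For $j\in\{0,1,\dots,k-1\}$ let $T^{(a,1)}_{(j,RS)}$ be the $a$-th power of the total distance travelled by the robot of capacity $k$, starting at the origin $0$, in the algorithm $GM_j(k,n)$, which moves each sensor $X_i$ to $X_i+M_i$. Let $T^{(a,1)}_{(AS)}=\sum_{i=1}^n|M_i|^a$. Then $$\min_{0\le j\le k-1}T^{(a,1)}_{(j,RS)}\le 6^aX_n^a+\left(4\left\lfloor\frac{n}{k}\right\rfloor+16\right)^{a-1}\left(2|M_1|^a+2|M_n|^a+\frac{4T^{(a,1)}_{(AS)}}{k}\right).$$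
   Context: The inequality is for every realization of the random positions. The robot moves on the real line and can carry at most $k$ sensors at a time; it may pick up and drop sensors anywhere. Greedy procedure $GP(Y_0,Y_1,\dots,Y_l)$, where $1\le l\le k$, $Y_0\le Y_1\le\dots\le Y_l$, and sensor $Y_i$ ($1\le i\le l$) has destination $Y_i+M_i$ with $Y_1+M_1\le\dots\le Y_l+M_l$: the robot starts at $Y_0$, moves right to $Y_l$ collecting the sensors $Y_1,\dots,Y_l$; then it places the sensors at their destinations in the order $l,l-1,\dots,1$ (going straight from $Y_l$ to $Y_l+M_l$, then leftwards from $Y_l+M_l$ to $Y_1+M_1$, dropping sensors on the way); finally it walks straight from $Y_1+M_1$ to $Y_l$, where it ends. Algorithm $GM_j(k,n)$ for $j\in\{0,\dots,k-1\}$, with the convention $X_0=0$ (the robot's start): 1. If $j>0$, execute $GP(X_0,X_1,\dots,X_j)$. 2. For $i=1,\dots,\lfloor (n-j)/k\rfloor$, execute $GP(X_{j+k(i-1)},X_{j+k(i-1)+1},\dots,X_{j+k(i-1)+k})$. 3. If $m:=j+k\lfloor (n-j)/k\rfloor<n$, execute $GP(X_m,X_{m+1},\dots,X_n)$. In each call, the sensor $X_i$ has destination $X_i+M_i$. *)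

theory Defs imports Complex_Main
begin

text \<open>A trajectory on the line is given by its successive waypoints; between two of them
  the robot walks straight.\<close>

definition travelled :: "real list \<Rightarrow> real" where
  "travelled ps = (\<Sum>i<length ps - 1. \<bar>ps ! Suc i - ps ! i\<bar>)"

text \<open>The trajectory of \<open>GP(X\<^sub>s, X\<^bsub>s+1\<^esub>, \<dots>, X\<^sub>t)\<close> for \<open>s < t\<close>: collect \<open>s+1, \<dots>, t\<close> on the way
  from \<open>X\<^sub>s\<close> to \<open>X\<^sub>t\<close>, drop them in the order \<open>t, \<dots>, s+1\<close>, and return to \<open>X\<^sub>t\<close>.
  The index \<open>s\<close> only provides the starting point.\<close>

definition gp_path :: "(nat \<Rightarrow> real) \<Rightarrow> (nat \<Rightarrow> real) \<Rightarrow> nat \<times> nat \<Rightarrow> real list" where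
  "gp_path X M = (\<lambda>(s, t).
     map X [s..<Suc t] @ map (\<lambda>i. X i + M i) (rev [Suc s..<Suc t]) @ [X t])"

text \<open>The calls of the greedy procedure made by \<open>GM\<^sub>j(k,n)\<close>, in order; a pair \<open>(s, t)\<close> stands
  for \<open>GP(X\<^sub>s, \<dots>, X\<^sub>t)\<close>.\<close>

definition gm_calls :: "nat \<Rightarrow> nat \<Rightarrow> nat \<Rightarrow> (nat \<times> nat) list" where
  "gm_calls k n j =
     (let q = (n - j) div k; m = j + k * q in
        (if j > 0 then [(0, j)] else [])
        @ map (\<lambda>i. (j + k * (i - 1), j + k * (i - 1) + k)) [1..<Suc q]
        @ (if m < n then [(m, n)] else []))"

text \<open>The update implements the convention \<open>X\<^sub>0 = 0\<close>. Each call starts where the previous one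
  ended, so concatenating the trajectories adds no distance at the junctions.\<close>

definition gm_path :: "(nat \<Rightarrow> real) \<Rightarrow> (nat \<Rightarrow> real) \<Rightarrow> nat \<Rightarrow> nat \<Rightarrow> nat \<Rightarrow> real list" where
  "gm_path X M k n j = concat (map (gp_path (X(0 := 0)) M) (gm_calls k n j))"

definition T_RS :: "real \<Rightarrow> (nat \<Rightarrow> real) \<Rightarrow> (nat \<Rightarrow> real) \<Rightarrow> nat \<Rightarrow> nat \<Rightarrow> nat \<Rightarrow> real" where
  "T_RS a X M k n j = travelled (gm_path X M k n j) powr a"

definition T_AS :: "real \<Rightarrow> (nat \<Rightarrow> real) \<Rightarrow> nat \<Rightarrow> real" where
  "T_AS a M n = (\<Sum>i=1..n. \<bar>M i\<bar> powr a)"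

end

theory Submission imports Defs "HOL-Analysis.Convex"
begin

text \<open>A call \<open>GP(X\<^sub>s, \<dots>, X\<^sub>t)\<close> costs at most
  \<open>(X\<^sub>t - X\<^sub>s) + 2 (X\<^sub>t - X\<^bsub>s+1\<^esub>) + 2 max(M\<^sub>t, 0) + 2 max(- M\<^bsub>s+1\<^esub>, 0)\<close>.
  At a junction \<open>t\<close> between consecutive calls, if both \<open>M\<^sub>t > 0\<close> and \<open>M\<^bsub>t+1\<^esub> < 0\<close> contribute, then
  they are paid by the gap \<open>X\<^bsub>t+1\<^esub> - X\<^sub>t\<close>; so the total is at most \<open>3 X\<^sub>n\<close> plus twice a sum
  of one displacement per junction together with \<open>\<bar>M\<^sub>1\<bar>\<close> and \<open>\<bar>M\<^sub>n\<bar>\<close>, in all at most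
  \<open>\<lfloor>n/k\<rfloor> + 3\<close> displacements. Convexity of the \<open>a\<close>-th power gives a bound for every \<open>j\<close>. The junctions
  of \<open>GM\<^sub>j\<close> are the \<open>t < n\<close> congruent to \<open>j\<close> modulo \<open>k\<close>, so averaging over \<open>j\<close> counts every
  displacement at most twice.\<close>

section \<open>Length of a trajectory\<close>

lemma travelled_Nil [simp]: "travelled [] = 0"
  and travelled_single [simp]: "travelled [x] = 0"
  by (simp_all add: travelled_def)

lemma travelled_Cons2 [simp]: "travelled (x # y # zs) = \<bar>y - x\<bar> + travelled (y # zs)"
  by (simp add: travelled_def sum.lessThan_Suc_shift del: sum.lessThan_Suc)

lemma travelled_append:
  "xs \<noteq> [] \<Longrightarrow> ys \<noteq> [] \<Longrightarrow>
    travelled (xs @ ys) = travelled xs + \<bar>hd ys - last xs\<bar> + travelled ys"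
proof (induction xs rule: induct_list012)
  case (2 x)
  then show ?case by (cases ys) auto
qed auto

lemma travelled_rev: "travelled (rev xs) = travelled xs"
proof (induction xs)
  case (Cons x xs)
  then show ?case
    using travelled_append[of "rev xs" "[x]"] by (cases xs) (simp_all add: abs_minus_commute)
qed simp

lemma travelled_mono:
  fixes f :: "nat \<Rightarrow> real"
  assumes "mono_on {s..t} f" and "s \<le> t"
  shows "travelled (map f [s..<Suc t]) = f t - f s"
  using assms(2,1)
proof (induction t rule: dec_induct)
  case (step t)
  from step.hyps have "map f [s..<Suc (Suc t)] = map f [s..<Suc t] @ [f (Suc t)]"
    by simp
  moreover have "mono_on {s..t} f"
    by (rule mono_on_subset[OF step.prems]) auto
  moreover have "f t \<le> f (Suc t)"
    using step.hyps by (intro mono_onD[OF step.prems]) auto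
  ultimately show ?case
    using step.IH step.hyps by (simp add: travelled_append last_map del: upt_Suc)
qed simp

section \<open>Cost of a single greedy call\<close>

lemma gp_path_neq_Nil [simp]: "gp_path X M c \<noteq> []"
  by (cases c) (simp add: gp_path_def)

lemma hd_gp_path: "s \<le> t \<Longrightarrow> hd (gp_path X M (s, t)) = X s"
  by (simp add: gp_path_def hd_append hd_map del: upt_Suc)

lemma last_gp_path: "last (gp_path X M (s, t)) = X t"
  by (simp add: gp_path_def)

lemma travelled_gp_path:
  assumes "s < t" "mono_on {s..t} X" "mono_on {Suc s..t} (\<lambda>i. X i + M i)"
  shows "travelled (gp_path X M (s, t)) = X t - X s + \<bar>M t\<bar>
    + (X t + M t - (X (Suc s) + M (Suc s))) + \<bar>X t - (X (Suc s) + M (Suc s))\<bar>"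
proof -
  define D where "D = map (\<lambda>i. X i + M i) [Suc s..<Suc t]"
  have D: "D \<noteq> []" "hd D = X (Suc s) + M (Suc s)" "last D = X t + M t"
    using assms(1) by (auto simp: D_def hd_map last_map simp del: upt_Suc)
  have "gp_path X M (s, t) = map X [s..<Suc t] @ rev D @ [X t]"
    by (simp add: gp_path_def D_def rev_map del: upt_Suc)
  moreover have "travelled D = X t + M t - (X (Suc s) + M (Suc s))"
    unfolding D_def using assms by (intro travelled_mono) auto
  ultimately show ?thesis
    using assms D travelled_mono[of s t X]
    by (simp add: travelled_append travelled_rev hd_rev last_rev last_map hd_append del: upt_Suc)
qed

text \<open>The signed differences in the exact length pair up with the absolute values, and
  \<open>\<bar>x\<bar> + x = 2 * max 0 x\<close>. So a leftward \<open>M t\<close> or a rightward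
  \<open>M (Suc s)\<close> costs nothing.\<close>

lemma gp_path_cost:
  assumes "s < t" "mono_on {s..t} X" "mono_on {Suc s..t} (\<lambda>i. X i + M i)"
  shows "travelled (gp_path X M (s, t)) \<le> X t - X s + 2 * (X t - X (Suc s))
    + 2 * max 0 (M t) + 2 * max 0 (- M (Suc s))"
proof -
  have "X (Suc s) \<le> X t"
    using assms(1) by (intro mono_onD[OF assms(2)]) auto
  then have "X t - (X (Suc s) + M (Suc s)) + \<bar>X t - (X (Suc s) + M (Suc s))\<bar>
      \<le> 2 * (X t - X (Suc s)) + 2 * max 0 (- M (Suc s))"
    by (simp add: max_def abs_if)
  moreover have "\<bar>M t\<bar> + M t = 2 * max 0 (M t)"
    by (simp add: max_def)
  ultimately show ?thesis
    unfolding travelled_gp_path[OF assms] by argo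
qed

section \<open>Consecutive calls\<close>

text \<open>Abstracts from the explicit list \<open>gm_calls\<close> what inductions over the calls
  need: they abut, and none is empty.\<close>

fun chain :: "nat \<Rightarrow> (nat \<times> nat) list \<Rightarrow> nat \<Rightarrow> bool" where
  "chain s [] e \<longleftrightarrow> s = e"
| "chain s ((u, v) # cs) e \<longleftrightarrow> u = s \<and> s < v \<and> chain v cs e"

lemma chain_append: "chain s (cs @ ds) e \<longleftrightarrow> (\<exists>m. chain s cs m \<and> chain m ds e)"
  by (induction s cs e rule: chain.induct) auto

lemma chain_le: "chain s cs e \<Longrightarrow> s \<le> e"
  by (induction s cs e rule: chain.induct) auto

lemma chain_gm_calls:
  assumes "1 \<le> k" "j \<le> n"
  shows "chain 0 (gm_calls k n j) n"
proof -
  define q m where "q = (n - j) div k" and "m = j + k * q"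
  have "m \<le> n"
    using assms times_div_less_eq_dividend[of k "n - j"] unfolding m_def q_def by linarith
  have mid: "chain j (map (\<lambda>i. (j + k * (i - 1), j + k * (i - 1) + k)) [1..<Suc r]) (j + k * r)" for r
    using assms by (induction r) (auto simp: chain_append)
  show ?thesis
    unfolding gm_calls_def Let_def q_def[symmetric] m_def[symmetric] chain_append
    using mid[of q] \<open>m \<le> n\<close> by (auto simp: m_def[symmetric] simp del: upt_Suc)
qed

text \<open>Start \<open>0\<close> is exempt because the opening call \<open>(0, j)\<close> begins
  there whatever \<open>j\<close> is.\<close>

lemma fst_gm_calls:
  assumes "j < k" "c \<in> set (gm_calls k n j)" "fst c \<noteq> 0"
  shows "fst c mod k = j"
  using assms by (auto simp: gm_calls_def Let_def split: if_splits)

lemma travelled_chain: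
  assumes "chain s cs e"
  shows "travelled (concat (map (gp_path X M) cs)) = (\<Sum>c\<leftarrow>cs. travelled (gp_path X M c))"
  using assms
proof (induction s cs e rule: chain.induct)
  case (2 s u v cs e)
  show ?case
  proof (cases cs)
    case (Cons d ds)
    with 2 obtain w where d: "d = (v, w)" "v < w"
      by (cases d) auto
    from 2 have "travelled (concat (map (gp_path X M) cs)) = (\<Sum>c\<leftarrow>cs. travelled (gp_path X M c))"
      by simp
    moreover have "hd (concat (map (gp_path X M) cs)) = X v"
      using Cons d by (simp add: hd_gp_path)
    ultimately show ?thesis
      using Cons by (simp add: travelled_append last_gp_path)
  qed simp
qed simp

text \<open>If \<open>M\<^sub>s > 0 > M\<^bsub>s+1\<^esub>\<close>, the order of the destinations gives
  \<open>M\<^sub>s - M\<^bsub>s+1\<^esub> \<le> X\<^bsub>s+1\<^esub> - X\<^sub>s\<close>, and this gap was crossed only once so far.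
  Hence only one displacement per junction has to be paid for.\<close>

lemma junction_cost:
  assumes "s < t" "mono_on {s..t} X" "mono_on {s..t} (\<lambda>i. X i + M i)"
  shows "2 * max 0 (M s) + travelled (gp_path X M (s, t))
    \<le> 3 * (X t - X s) + 2 * max 0 (M t) + 2 * max \<bar>M s\<bar> \<bar>M (Suc s)\<bar>"
proof -
  have "X s \<le> X (Suc s)" "X s + M s \<le> X (Suc s) + M (Suc s)"
    using assms(1) by (auto intro!: mono_onD[OF assms(2)] mono_onD[OF assms(3)])
  then have "2 * max 0 (M s) + 2 * max 0 (- M (Suc s))
      \<le> 2 * (X (Suc s) - X s) + 2 * max \<bar>M s\<bar> \<bar>M (Suc s)\<bar>"
    by (auto simp: max_def abs_if)
  moreover have "mono_on {Suc s..t} (\<lambda>i. X i + M i)"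
    by (rule mono_on_subset[OF assms(3)]) auto
  \<comment> \<open>The gap \<open>X (Suc s) - X s\<close> completes
    \<open>2 * (X t - X (Suc s))\<close> to \<open>2 * (X t - X s)\<close>, whence the factor
    3.\<close>
  ultimately show ?thesis
    using gp_path_cost[OF assms(1,2)] by fastforce
qed

text \<open>The term \<open>2 * max 0 (M s)\<close> is the debt left by the call ending at
  \<open>s\<close>. Carrying it along makes the bounds of \<open>junction_cost\<close>
  telescope.\<close>

lemma chain_cost:
  assumes "chain s cs e" "mono_on {s..e} X" "mono_on {s..e} (\<lambda>i. X i + M i)"
    and "\<And>c. c \<in> set cs \<Longrightarrow> P (fst c)"
  shows "2 * max 0 (M s) + (\<Sum>c\<leftarrow>cs. travelled (gp_path X M c))
    \<le> 3 * (X e - X s) + 2 * max 0 (M e)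
      + 2 * (\<Sum>t | s \<le> t \<and> t < e \<and> P t. max \<bar>M t\<bar> \<bar>M (Suc t)\<bar>)"
  using assms
proof (induction s cs e rule: chain.induct)
  case (1 s e)
  have "0 \<le> (\<Sum>t | s \<le> t \<and> t < e \<and> P t. max \<bar>M t\<bar> \<bar>M (Suc t)\<bar>)"
    by (intro sum_nonneg) (simp add: le_max_iff_disj)
  moreover have "s = e" using 1 by simp
  ultimately show ?case by simp
next
  case (2 s u v cs e)
  let ?G = "\<lambda>t. max \<bar>M t\<bar> \<bar>M (Suc t)\<bar>"
  have uv: "u = s" "s < v" "v \<le> e" "P s"
    using 2(2) 2(5)[of "(u, v)"] chain_le[of v cs e] by auto
  have "?G s + (\<Sum>t | v \<le> t \<and> t < e \<and> P t. ?G t)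
      = sum ?G (insert s {t. v \<le> t \<and> t < e \<and> P t})"
    using uv by simp
  also have "\<dots> \<le> (\<Sum>t | s \<le> t \<and> t < e \<and> P t. ?G t)"
    using uv by (intro sum_mono2) (auto simp: max_def)
  finally have G: "?G s + (\<Sum>t | v \<le> t \<and> t < e \<and> P t. ?G t)
      \<le> (\<Sum>t | s \<le> t \<and> t < e \<and> P t. ?G t)" .
  have "2 * max 0 (M v) + (\<Sum>c\<leftarrow>cs. travelled (gp_path X M c))
    \<le> 3 * (X e - X v) + 2 * max 0 (M e) + 2 * (\<Sum>t | v \<le> t \<and> t < e \<and> P t. ?G t)"
    using 2 uv by (intro 2(1)) (auto intro: mono_on_subset)
  moreover have "2 * max 0 (M s) + travelled (gp_path X M (s, v))
    \<le> 3 * (X v - X s) + 2 * max 0 (M v) + 2 * ?G s"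
    using 2 uv by (intro junction_cost) (auto intro: mono_on_subset)
  ultimately show ?case
    using G uv by (simp add: algebra_simps)
qed

text \<open>No sensor sits at index 0, so the first call is bounded by \<open>gp_path_cost\<close>
  alone, with its leftward part charged to \<open>\<bar>M 1\<bar>\<close>. Its debt at
  \<open>v\<close> is the one that \<open>chain_cost\<close> absorbs.\<close>

lemma gm_path_cost:
  assumes "j < k" "k \<le> n" "0 \<le> X 1"
    and X: "mono_on {1..n} X" and Y: "mono_on {1..n} (\<lambda>i. X i + M i)"
  shows "travelled (gm_path X M k n j) \<le> 3 * X n + 2 * (\<bar>M 1\<bar> + \<bar>M n\<bar>
    + (\<Sum>t | 1 \<le> t \<and> t < n \<and> t mod k = j. max \<bar>M t\<bar> \<bar>M (Suc t)\<bar>))"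
proof -
  define Z where "Z = X(0 := 0)"
  let ?G = "\<lambda>t. max \<bar>M t\<bar> \<bar>M (Suc t)\<bar>"
  have chain: "chain 0 (gm_calls k n j) n"
    using assms by (intro chain_gm_calls) auto
  have Z: "mono_on {0..n} Z"
  proof (rule mono_onI)
    fix r s assume rs: "r \<in> {0..n}" "s \<in> {0..n}" "r \<le> s"
    show "Z r \<le> Z s"
    proof (cases "r = 0 \<and> s \<noteq> 0")
      case True
      then have "X 1 \<le> X s" using rs by (intro mono_onD[OF X]) auto
      then show ?thesis using True assms(3) by (simp add: Z_def)
    next
      case False
      then show ?thesis using rs by (auto simp: Z_def intro!: mono_onD[OF X])
    qed
  qed
  have Y': "mono_on {1..n} (\<lambda>i. Z i + M i)"
    using Y by (auto simp: Z_def mono_on_def)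
  from chain assms obtain v cs where calls: "gm_calls k n j = (0, v) # cs"
    by (cases "gm_calls k n j") auto
  with chain have v: "0 < v" "chain v cs n" "v \<le> n"
    using chain_le by auto
  have pos: "0 < fst c" if "chain s ds e" "0 < s" "c \<in> set ds" for s ds e c
    using that by (induction s ds e rule: chain.induct) auto
  have "2 * max 0 (M v) + (\<Sum>c\<leftarrow>cs. travelled (gp_path Z M c)) \<le> 3 * (Z n - Z v) + 2 * max 0 (M n)
      + 2 * (\<Sum>t | v \<le> t \<and> t < n \<and> t mod k = j. ?G t)"
  proof (rule chain_cost)
    fix c assume c: "c \<in> set cs"
    show "fst c mod k = j"
      using c calls pos[OF v(2,1) c] assms(1) by (intro fst_gm_calls[of j k c n]) auto
  qed (use v in \<open>auto intro: mono_on_subset[OF Z] mono_on_subset[OF Y']\<close>)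
  moreover have "travelled (gp_path Z M (0, v)) \<le> Z v - Z 0 + 2 * (Z v - Z (Suc 0))
      + 2 * max 0 (M v) + 2 * max 0 (- M (Suc 0))"
    using v by (intro gp_path_cost) (auto intro: mono_on_subset[OF Z] mono_on_subset[OF Y'])
  moreover have "(\<Sum>t | v \<le> t \<and> t < n \<and> t mod k = j. ?G t)
      \<le> (\<Sum>t | 1 \<le> t \<and> t < n \<and> t mod k = j. ?G t)"
    using v by (intro sum_mono2) (auto simp: max_def)
  moreover have "Z 0 = 0" "Z (Suc 0) \<ge> 0" "Z n = X n"
    using assms v by (auto simp: Z_def)
  moreover have "travelled (gm_path X M k n j)
      = travelled (gp_path Z M (0, v)) + (\<Sum>c\<leftarrow>cs. travelled (gp_path Z M c))"
    using travelled_chain[OF chain, of Z M] by (simp add: gm_path_def Z_def calls)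
  moreover have "max 0 (M n) \<le> \<bar>M n\<bar>" "max 0 (- M (Suc 0)) \<le> \<bar>M (Suc 0)\<bar>"
    by auto
  ultimately show ?thesis
    unfolding distrib_left One_nat_def by argo
qed

section \<open>Powers, counting and averaging\<close>

text \<open>Jensen's inequality with equal weights for the convex function
  \<open>x powr a\<close>.\<close>

lemma power_mean:
  fixes y :: "'a \<Rightarrow> real"
  assumes "finite A" "\<And>i. i \<in> A \<Longrightarrow> 0 \<le> y i" "1 \<le> a"
  shows "(\<Sum>i\<in>A. y i) powr a \<le> real (card A) powr (a - 1) * (\<Sum>i\<in>A. y i powr a)"
proof -
  \<comment> \<open>Zero terms are dropped because \<open>powr_convex\<close> only covers the open half-line.\<close>
  define B where "B = {i \<in> A. 0 < y i}"
  have B: "finite B" "B \<subseteq> A" "\<And>i. i \<in> A - B \<Longrightarrow> y i = 0"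
    using assms by (fastforce simp: B_def)+
  have sums: "(\<Sum>i\<in>A. y i) = (\<Sum>i\<in>B. y i)" "(\<Sum>i\<in>A. y i powr a) = (\<Sum>i\<in>B. y i powr a)"
    using B assms(1) by (auto intro!: sum.mono_neutral_right)
  have card: "card B \<le> card A"
    by (intro card_mono assms B)
  show ?thesis
  proof (cases "B = {}")
    case False
    define N where "N = real (card B)"
    have N: "0 < N" using False B(1) by (simp add: N_def card_gt_0_iff)
    have pos: "0 < (\<Sum>i\<in>B. y i)"
      using False B(1) by (intro sum_pos) (auto simp: B_def)
    have "(\<Sum>i\<in>B. (1 / N) *\<^sub>R y i) powr a \<le> (\<Sum>i\<in>B. 1 / N * (y i powr a))"
    proof (rule convex_on_sum[OF B(1) False powr_convex[OF assms(3)]])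
      show "(\<Sum>i\<in>B. 1 / N) = 1" using N by (simp add: N_def)
    qed (use N in \<open>auto simp: B_def\<close>)
    then have "((\<Sum>i\<in>B. y i) / N) powr a \<le> (\<Sum>i\<in>B. y i powr a) / N"
      by (simp add: sum_divide_distrib)
    then have "(\<Sum>i\<in>B. y i) powr a \<le> N powr (a - 1) * (\<Sum>i\<in>B. y i powr a)"
      using N pos by (simp add: powr_divide powr_diff field_simps)
    also have "\<dots> \<le> real (card A) powr (a - 1) * (\<Sum>i\<in>B. y i powr a)"
      using assms(3) N card by (intro mult_right_mono powr_mono2 sum_nonneg) (auto simp: N_def)
    finally show ?thesis by (simp add: sums)
  qed (simp add: sums)
qed

text \<open>Within a residue class, \<open>t\<close> is determined by \<open>t div k\<close>, which
  lies between 0 and \<open>n div k\<close>.\<close>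

lemma card_residue_class:
  fixes k n j :: nat
  shows "card {t \<in> {1..<n}. t mod k = j} \<le> n div k + 1"
proof -
  have "inj_on (\<lambda>t. t div k) {t \<in> {1..<n}. t mod k = j}"
    by (rule inj_onI) (metis (lifting) div_mult_mod_eq mem_Collect_eq)
  moreover have "(\<lambda>t. t div k) ` {t \<in> {1..<n}. t mod k = j} \<subseteq> {..n div k}"
    by (auto intro: div_le_mono)
  ultimately have "card {t \<in> {1..<n}. t mod k = j} \<le> card {..n div k}"
    by (rule card_inj_on_le) simp
  then show ?thesis by simp
qed

lemma T_RS_le:
  assumes "1 \<le> a" "j < k" "k \<le> n" "0 \<le> X 1"
    and X: "mono_on {1..n} X" and Y: "mono_on {1..n} (\<lambda>i. X i + M i)"
  shows "T_RS a X M k n j \<le> 6 powr a * X n powr a / 2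
    + 2 * (4 * real (n div k) + 16) powr (a - 1) * (\<bar>M 1\<bar> powr a + \<bar>M n\<bar> powr a
      + (\<Sum>t \<in> {t \<in> {1..<n}. t mod k = j}. \<bar>M t\<bar> powr a + \<bar>M (Suc t)\<bar> powr a))"
proof -
  define J where "J = {t \<in> {1..<n}. t mod k = j}"
  \<comment> \<open>The indices 0 and \<open>n\<close> lie outside \<open>J\<close>, so they are
    free to carry the two boundary displacements.\<close>
  define y where "y t = (if t = 0 then \<bar>M 1\<bar> else if t = n then \<bar>M n\<bar>
    else max \<bar>M t\<bar> \<bar>M (Suc t)\<bar>)" for t
  define A where "A = insert 0 (insert n J)"
  define S where "S = (\<Sum>t\<in>A. y t)"
  define R where "R = \<bar>M 1\<bar> powr a + \<bar>M n\<bar> powr a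
    + (\<Sum>t\<in>J. \<bar>M t\<bar> powr a + \<bar>M (Suc t)\<bar> powr a)"
  have n: "0 < n" using assms by simp
  have J: "finite J" "0 \<notin> J" "n \<notin> J" by (auto simp: J_def)
  have Aeq: "(\<Sum>t\<in>A. f (y t)) = f \<bar>M 1\<bar> + f \<bar>M n\<bar> + (\<Sum>t\<in>J. f (max \<bar>M t\<bar> \<bar>M (Suc t)\<bar>))"
    for f :: "real \<Rightarrow> real"
  proof -
    have "(\<Sum>t\<in>J. f (y t)) = (\<Sum>t\<in>J. f (max \<bar>M t\<bar> \<bar>M (Suc t)\<bar>))"
      using J by (intro sum.cong) (auto simp: y_def)
    then show ?thesis using n J by (simp add: A_def y_def[of 0] y_def[of n])
  qed
  have y0: "0 \<le> y t" for t by (simp add: y_def le_max_iff_disj)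
  then have S0: "0 \<le> S" by (simp add: S_def sum_nonneg)
  have R0: "0 \<le> R" by (simp add: R_def sum_nonneg)
  have X0: "0 \<le> X n"
    using assms(4) mono_onD[OF X, of 1 n] n by simp
  \<comment> \<open>\<open>A\<close> has at most \<open>n div k + 3\<close> elements, so 12 would do
    in place of 16.\<close>
  have cardA: "4 * real (card A) \<le> 4 * real (n div k) + 16"
    using card_residue_class[of n k j] n J unfolding J_def[symmetric] by (simp add: A_def)
  have A0: "finite A" "card A \<noteq> 0" using J by (simp_all add: A_def)
  have "(\<Sum>t\<in>A. y t powr a) \<le> R"
    unfolding Aeq[of "\<lambda>x. x powr a"] R_def by (intro add_left_mono sum_mono) (auto simp: max_def)
  with power_mean[of A y a] have SR: "S powr a \<le> real (card A) powr (a - 1) * R"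
    using A0 y0 assms(1) unfolding S_def
    by (meson mult_left_mono order_trans powr_ge_zero)
  have "travelled (gm_path X M k n j) \<le> 3 * X n + 2 * S"
  proof -
    have "{t. 1 \<le> t \<and> t < n \<and> t mod k = j} = J" by (auto simp: J_def)
    then show ?thesis
      using gm_path_cost[OF assms(2-6)] Aeq[of "\<lambda>x. x"] by (simp add: S_def)
  qed
  then have "T_RS a X M k n j \<le> (3 * X n + 2 * S) powr a"
    unfolding T_RS_def using assms(1) by (intro powr_mono2) (auto simp: travelled_def intro!: sum_nonneg)
  \<comment> \<open>Power mean of two terms, indexed by \<open>bool\<close>.\<close>
  also have "\<dots> \<le> 2 powr (a - 1) * ((3 * X n) powr a + (2 * S) powr a)"
    using power_mean[of UNIV "\<lambda>b. if b then 3 * X n else 2 * S" a] X0 S0 assms(1)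
    by (simp add: UNIV_bool add.commute)
  also have "\<dots> = 6 powr a * X n powr a / 2 + 4 powr a / 2 * S powr a"
  proof -
    have "(6::real) powr a = 2 powr a * 3 powr a" "(4::real) powr a = 2 powr a * 2 powr a"
      by (simp_all flip: powr_mult)
    then show ?thesis
      using X0 S0 by (simp add: powr_mult powr_diff algebra_simps)
  qed
  also have "\<dots> \<le> 6 powr a * X n powr a / 2 + 2 * ((4 * real (card A)) powr (a - 1) * R)"
  proof -
    have "4 powr a / 2 * S powr a \<le> 4 powr a / 2 * (real (card A) powr (a - 1) * R)"
      by (intro mult_left_mono SR) simp
    \<comment> \<open>Here \<open>4 powr a / 2 = 2 * 4 powr (a - 1)\<close>, and the power of 4
      moves into the base.\<close>
    also have "\<dots> = 2 * ((4 * real (card A)) powr (a - 1) * R)"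
      by (simp add: powr_mult powr_diff)
    finally show ?thesis by simp
  qed
  also have "\<dots> \<le> 6 powr a * X n powr a / 2 + 2 * ((4 * real (n div k) + 16) powr (a - 1) * R)"
    using assms(1) cardA R0 by (intro add_left_mono mult_left_mono mult_right_mono powr_mono2) auto
  finally show ?thesis by (simp add: R_def J_def mult.assoc)
qed

theorem theorem2:
  fixes a :: real and k n :: nat and X M :: "nat \<Rightarrow> real"
  assumes "1 \<le> a"
    and "1 \<le> k" and "k \<le> n"
    and "0 \<le> X 1"
    and "mono_on {1..n} X"
    and "mono_on {1..n} (\<lambda>i. X i + M i)"
  shows "Min ((\<lambda>j. T_RS a X M k n j) ` {0..k - 1})
    \<le> 6 powr a * X n powr a
      + (4 * real (n div k) + 16) powr (a - 1)
        * (2 * \<bar>M 1\<bar> powr a + 2 * \<bar>M n\<bar> powr a + 4 * T_AS a M n / real k)"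
proof -
  let ?min = "Min ((\<lambda>j. T_RS a X M k n j) ` {0..k - 1})"
  define C where "C = 6 powr a * X n powr a"
  define D where "D = (4 * real (n div k) + 16) powr (a - 1)"
  define E where "E = \<bar>M 1\<bar> powr a + \<bar>M n\<bar> powr a"
  define g where "g t = \<bar>M t\<bar> powr a + \<bar>M (Suc t)\<bar> powr a" for t
  have C0: "0 \<le> C" and D0: "0 \<le> D" by (simp_all add: C_def D_def)
  have k: "0 < k" using assms by simp
  \<comment> \<open>The residue classes modulo \<open>k\<close> partition
    \<open>{1..<n}\<close>.\<close>
  have "(\<Sum>j<k. \<Sum>t \<in> {t \<in> {1..<n}. t mod k = j}. g t) = (\<Sum>t\<in>{1..<n}. g t)"
    using k by (intro sum.group) auto
  also have "\<dots> \<le> 2 * T_AS a M n"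
  proof -
    have "(\<Sum>t\<in>{1..<n}. \<bar>M t\<bar> powr a) \<le> T_AS a M n"
      unfolding T_AS_def by (intro sum_mono2) auto
    moreover have "(\<Sum>t\<in>{1..<n}. \<bar>M (Suc t)\<bar> powr a) \<le> T_AS a M n"
      unfolding T_AS_def sum.shift_bounds_Suc_ivl[of "\<lambda>t. \<bar>M t\<bar> powr a", symmetric]
      by (intro sum_mono2) auto
    ultimately show ?thesis by (simp add: g_def sum.distrib)
  qed
  finally have G: "(\<Sum>j<k. \<Sum>t \<in> {t \<in> {1..<n}. t mod k = j}. g t) \<le> 2 * T_AS a M n" .
  \<comment> \<open>The minimum is at most the average over \<open>j\<close>.\<close>
  have "real k * ?min = (\<Sum>j<k. ?min)" by simp
  also have "\<dots> \<le> (\<Sum>j<k. C / 2 + 2 * D * (E + (\<Sum>t \<in> {t \<in> {1..<n}. t mod k = j}. g t)))"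
  proof (rule sum_mono)
    fix j assume "j \<in> {..<k}"
    then have "?min \<le> T_RS a X M k n j" by (intro Min_le) auto
    also have "\<dots> \<le> C / 2 + 2 * D * (E + (\<Sum>t \<in> {t \<in> {1..<n}. t mod k = j}. g t))"
      unfolding C_def D_def E_def g_def using assms \<open>j \<in> {..<k}\<close> by (intro T_RS_le) auto
    finally show "?min \<le> C / 2 + 2 * D * (E + (\<Sum>t \<in> {t \<in> {1..<n}. t mod k = j}. g t))" .
  qed
  also have "\<dots> = real k * (C / 2 + 2 * D * E)
      + 2 * D * (\<Sum>j<k. \<Sum>t \<in> {t \<in> {1..<n}. t mod k = j}. g t)"
    by (simp add: sum.distrib sum_distrib_left algebra_simps)
  \<comment> \<open>The coefficient 4 of \<open>T_AS\<close> is the 2 in front of \<open>D\<close>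
    times the 2 from \<open>G\<close>; \<open>C / 2\<close> is relaxed to \<open>C\<close>.\<close>
  also have "\<dots> \<le> real k * (C + 2 * D * E) + 2 * D * (2 * T_AS a M n)"
    using C0 D0 by (intro add_mono mult_left_mono G) auto
  also have "\<dots> = real k * (C + D * (2 * \<bar>M 1\<bar> powr a + 2 * \<bar>M n\<bar> powr a + 4 * T_AS a M n / real k))"
    using k by (simp add: E_def field_simps)
  finally show ?thesis
    using k by (simp add: C_def D_def)
qed

end
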